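(* Let $\Gamma$ be a finite, connected, simple, undirected graph with at least one edge, $G$ a group, and $s_1,s_2\in Z(G)$ with $s_1^2=s_2^2=1_G$. For $H_1,H_2\in\mathcal H_\Gamma$ the following are equivalent: (1) $H_1\sim_{l\times r}H_2$; (2) $\Psi(H_1)$ and $\Psi(H_2)$ are switching equivalent; (3) $\Psi_L(H_1)$ and $\Psi_L(H_2)$ are switching equivalent. In particular, there exists an injective map $\mathcal L\colon[G(\Gamma)]\to[G(L(\Gamma))]$ such that $\mathcal L([\Psi(H)])=[\Psi_L(H)]$ for every $H\in\mathcal H_\Gamma$.
   Context: Fix orders $V_\Gamma=\{v_1,\dots,v_n\}$, $E_\Gamma=\{e_1,\dots,e_m\}$; write $v_i\in e_j$ if $v_i$ is an endpoint of $e_j$, and $e_i\cap e_j$ for the common endpoint of distinct edges sharing a vertex. $\mathbb CG$ is the complex group algebra with involution $(\sum f_xx)^*=\sum\overline{f_x}x^{-1}$, and $(A^* )_{i,j}=(A_{j,i})^*$. A $G$-phase is $H\in M_{n\times m}(\mathbb CG)$ with $H_{i,j}\in G$ if $v_i\in e_j$ and $H_{i,j}=0$ otherwise; $\mathcal H_\Gamma$ is their set. For $g\in G^k$, $\underline g=\mathrm{diag}(g_1,\dots,g_k)$; $H_1\sim_{l\times r}H_2$ means $H_1=\underline f^{\,*}H_2\underline g$ for some $f\in G^n,g\in G^m$. A $G$-gain function on a graph is a map $\psi$ on ordered pairs of adjacent vertices into $G$ with $\psi(v,u)=\psi(u,v)^{-1}$; $G(\Gamma)$ is the set of such on $\Gamma$.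 Two gain functions $\psi_1,\psi_2$ on the same graph are switching equivalent if there is a map $f$ from vertices to $G$ with $\psi_2(u,v)=f(u)^{-1}\psi_1(u,v)f(v)$ for all adjacent $u,v$; $[G(\Gamma)]$ is the set of switching classes and $[\psi]$ the class of $\psi$. $\Psi(H)$ is the gain function on $\Gamma$ with $\Psi(H)(v_i,v_j)=s_1H_{i,k}H_{j,k}^{-1}$ for $e_k=\{v_i,v_j\}$. The line graph $L(\Gamma)$ has vertex set $E_\Gamma$, $e_i\sim e_j$ iff they share an endpoint; $\Psi_L(H)$ is the gain function on $L(\Gamma)$ with $\Psi_L(H)(e_i,e_j)=s_2H_{k,i}^{-1}H_{k,j}$ for $v_k=e_i\cap e_j$. *)

theory Defs
  imports
    Complex_Main
    "HOL-Library.FuncSet"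
    "HOL-Library.Poly_Mapping"
    "Jordan_Normal_Form.Matrix"
    "Graph_Theory.Graph_Theory"
begin

section \<open>The group and its complex group algebra\<close>

text \<open>
  The group \<open>G\<close> is a type \<open>'g\<close> of class \<^class>\<open>group_add\<close>.  Despite the additive notation this
  class does not assume commutativity: it is the library's class of arbitrary groups, and
  \<open>0\<close>, \<open>g + h\<close>, \<open>- g\<close>, \<open>g - h\<close> stand for \<open>1\<close>, \<open>gh\<close>, \<open>g\<inverse>\<close>, \<open>gh\<inverse>\<close>.
  The group algebra is the type \<open>'g \<Rightarrow>\<^sub>0 complex\<close> of finitely supported functions, whose library
  multiplication is the convolution product.
\<close>

definition group_center :: "'g::group_add set" where
  "group_center = {s. \<forall>g. s + g = g + s}"

type_synonym 'g group_algebra = "'g \<Rightarrow>\<^sub>0 complex"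

text \<open>The inclusion of \<open>G\<close> into its group algebra, and its inverse on the image.\<close>

definition gelem :: "'g::group_add \<Rightarrow> 'g group_algebra" where
  "gelem g = Poly_Mapping.single g 1"

definition gval :: "'g::group_add group_algebra \<Rightarrow> 'g" where
  "gval = the_inv gelem"

definition ga_star :: "'g::group_add group_algebra \<Rightarrow> 'g group_algebra" where
  "ga_star f = (\<Sum>x\<in>Poly_Mapping.keys f. Poly_Mapping.single (- x) (cnj (Poly_Mapping.lookup f x)))"

lemma inj_gelem: "inj gelem"
  by (auto simp: inj_def gelem_def dest!: arg_cong[where f = Poly_Mapping.keys])

lemma gval_gelem [simp]: "gval (gelem g) = g"
  by (simp add: gval_def the_inv_f_f inj_gelem)

lemma gelem_zero: "gelem 0 = 1"
  by (simp add: gelem_def)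

lemma gelem_add: "gelem (g + h) = gelem g * gelem h"
  by (simp add: gelem_def mult_single)

lemma ga_star_gelem [simp]: "ga_star (gelem g) = gelem (- g)"
  by (simp add: ga_star_def gelem_def)

definition mat_star :: "'g::group_add group_algebra mat \<Rightarrow> 'g group_algebra mat" where
  "mat_star A = Matrix.mat (dim_col A) (dim_row A) (\<lambda>(i, j). ga_star (A $$ (j, i)))"

text \<open>
  The diagonal matrix of a tuple in \<open>G\<^sup>k\<close>.  A tuple is given by a function of which only the values
  at \<open>0, \<dots>, k - 1\<close> matter; matrix and vertex indices start at \<open>0\<close>.
\<close>

definition gdiag :: "nat \<Rightarrow> (nat \<Rightarrow> 'g::group_add) \<Rightarrow> 'g group_algebra mat" where
  "gdiag k g = mat_diag k (\<lambda>i. gelem (g i))"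


section \<open>Graphs\<close>

text \<open>
  A finite simple undirected graph is a \<^locale>\<open>pair_graph\<close>: a finite loop-free symmetric set of arcs.
  Its arcs are the ordered pairs of adjacent vertices; its edges are the corresponding
  unordered pairs.
\<close>

definition edges :: "'v pair_pre_digraph \<Rightarrow> 'v set set" where
  "edges \<Gamma> = {{u, v} |u v. (u, v) \<in> parcs \<Gamma>}"

definition line_graph :: "'v pair_pre_digraph \<Rightarrow> 'v set pair_pre_digraph" where
  "line_graph \<Gamma> =
     \<lparr> pverts = edges \<Gamma>,
       parcs = {(e, e'). e \<in> edges \<Gamma> \<and> e' \<in> edges \<Gamma> \<and> e \<noteq> e' \<and> e \<inter> e' \<noteq> {}} \<rparr>"

text \<open>\<open>enumerates xs A\<close>: the list \<open>xs\<close> fixes an order of the finite set \<open>A\<close>.\<close>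

definition enumerates :: "'a list \<Rightarrow> 'a set \<Rightarrow> bool" where
  "enumerates xs A \<longleftrightarrow> distinct xs \<and> set xs = A"

text \<open>The position of an element in a list without repetitions.\<close>

definition index_in :: "'a list \<Rightarrow> 'a \<Rightarrow> nat" where
  "index_in xs = the_inv_into {..<length xs} (nth xs)"


section \<open>Gain functions and switching\<close>

text \<open>Gain functions are maps on the set of arcs, so they are normalised to
  \<^const>\<open>undefined\<close> off that set.\<close>

definition gain_functions :: "'v pair_pre_digraph \<Rightarrow> ('v \<times> 'v \<Rightarrow> 'g::group_add) set" where
  "gain_functions \<Gamma> =
     {\<psi> \<in> extensional (parcs \<Gamma>). \<forall>(u, v)\<in>parcs \<Gamma>. \<psi> (v, u) = - \<psi> (u, v)}"

definition switching ::
    "'v pair_pre_digraph \<Rightarrow> (('v \<times> 'v \<Rightarrow> 'g::group_add) \<times> ('v \<times> 'v \<Rightarrow> 'g)) set" where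
  "switching \<Gamma> =
     {(\<psi>1, \<psi>2). \<psi>1 \<in> gain_functions \<Gamma> \<and> \<psi>2 \<in> gain_functions \<Gamma> \<and>
        (\<exists>f :: 'v \<Rightarrow> 'g. \<forall>(u, v)\<in>parcs \<Gamma>. \<psi>2 (u, v) = - f u + \<psi>1 (u, v) + f v)}"

definition switching_class ::
    "'v pair_pre_digraph \<Rightarrow> ('v \<times> 'v \<Rightarrow> 'g::group_add) \<Rightarrow> ('v \<times> 'v \<Rightarrow> 'g) set" where
  "switching_class \<Gamma> \<psi> = switching \<Gamma> `` {\<psi>}"

definition switching_classes :: "'v pair_pre_digraph \<Rightarrow> ('v \<times> 'v \<Rightarrow> 'g::group_add) set set" where
  "switching_classes \<Gamma> = gain_functions \<Gamma> // switching \<Gamma>"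


section \<open>Phases and their gain functions\<close>

text \<open>Below, \<open>vs\<close> and \<open>es\<close> are the chosen orders of the vertices and of the edges.\<close>

definition phases :: "'v list \<Rightarrow> 'v set list \<Rightarrow> 'g::group_add group_algebra mat set" where
  "phases vs es =
     {H \<in> carrier_mat (length vs) (length es).
        \<forall>i<length vs. \<forall>j<length es.
          if vs ! i \<in> es ! j then H $$ (i, j) \<in> range gelem else H $$ (i, j) = 0}"

definition lr_equiv ::
    "nat \<Rightarrow> nat \<Rightarrow> 'g::group_add group_algebra mat \<Rightarrow> 'g group_algebra mat \<Rightarrow> bool" where
  "lr_equiv n m H1 H2 \<longleftrightarrow>
     (\<exists>f g :: nat \<Rightarrow> 'g. H1 = mat_star (gdiag n f) * H2 * gdiag m g)"

definition phase_gain ::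
    "'v pair_pre_digraph \<Rightarrow> 'v list \<Rightarrow> 'v set list \<Rightarrow> 'g::group_add \<Rightarrow>
     'g group_algebra mat \<Rightarrow> 'v \<times> 'v \<Rightarrow> 'g" where
  "phase_gain \<Gamma> vs es s H =
     (\<lambda>(u, v)\<in>parcs \<Gamma>.
        let i = index_in vs u; j = index_in vs v; k = index_in es {u, v}
        in s + gval (H $$ (i, k)) - gval (H $$ (j, k)))"

definition phase_line_gain ::
    "'v pair_pre_digraph \<Rightarrow> 'v list \<Rightarrow> 'v set list \<Rightarrow> 'g::group_add \<Rightarrow>
     'g group_algebra mat \<Rightarrow> 'v set \<times> 'v set \<Rightarrow> 'g" where
  "phase_line_gain \<Gamma> vs es s H =
     (\<lambda>(e, e')\<in>parcs (line_graph \<Gamma>).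
        let i = index_in es e; j = index_in es e'; k = index_in vs (the_elem (e \<inter> e'))
        in s + (- gval (H $$ (k, i))) + gval (H $$ (k, j)))"

end

(* A phase H is a G-labelling h of the incident pairs (v, e).  Each of the three conditions says
   that h1 v e = (f v)^-1 (h2 v e) (g e) for some f on vertices and g on edges.  A switching
   function f for the gains on the graph makes (h1 v e)^-1 (f v) (h2 v e) independent of the
   endpoint v of e, and this common value gives g; dually, a switching function g for the gains on
   the line graph makes (h1 v e) (g e) (h2 v e)^-1 independent of the edge e at v, which gives f.
   The map on switching classes exists because every gain function is the gain function of a phase:
   put the identity at one chosen endpoint of each edge and the gain, times s1, at the other. *)

theory Submission
  imports Defs
begin

section \<open>Group identities\<close>

text \<open>Being central, \<open>s\<close> can be moved to the front and cancelled; multiplying by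
  \<open>- a + x\<close> on the left and by \<open>d\<close> on the right then separates the
  variables. With \<open>a\<close>, \<open>b\<close> the entries of one phase at the two ends of an
  edge, \<open>c\<close>, \<open>d\<close> those of another phase and \<open>x\<close>,
  \<open>y\<close> the switching values, the two sides become one and the same expression taken at
  either end.\<close>

lemma gain_switch_iff:
  fixes s :: "'g::group_add"
  assumes "s \<in> group_center"
  shows "s + c - d = - x + (s + a - b) + y \<longleftrightarrow> - a + x + c = - b + y + d"
proof -
  have s: "\<And>z. z + s = s + z"
    using assms by (simp add: group_center_def)
  have "- x + (s + a - b) + y = (- x + s) + (a - b + y)"
    by (simp only: diff_conv_add_uminus add.assoc)
  also have "\<dots> = s + (- x + (a - b + y))"
    by (simp only: s add.assoc)
  finally have "s + c - d = - x + (s + a - b) + y \<longleftrightarrow> c - d = - x + (a - b + y)"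
    by (simp add: diff_conv_add_uminus add.assoc del: add_uminus_conv_diff)
  also have "\<dots> \<longleftrightarrow> (- a + x) + (c - d) + d = (- a + x) + (- x + (a - b + y)) + d"
    by (simp only: add_left_cancel add_right_cancel)
  also have "\<dots> \<longleftrightarrow> - a + x + c = - b + y + d"
    by (simp add: diff_conv_add_uminus add.assoc del: add_uminus_conv_diff)
  finally show ?thesis .
qed

text \<open>The line gain has the inverse on its first factor instead of its second, so this is the
  previous identity applied to the inverses of \<open>a\<close>, \<open>b\<close>, \<open>c\<close>,
  \<open>d\<close>.\<close>

lemma line_gain_switch_iff:
  fixes s :: "'g::group_add"
  assumes "s \<in> group_center"
  shows "s + - c + d = - x + (s + - a + b) + y \<longleftrightarrow> a + x - c = b + y - d"
  using gain_switch_iff[OF assms, of "- c" "- d" x "- a" "- b" y] by simp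

text \<open>This is where the sign has to be a central involution: reversing an arc then inverts its
  gain. It serves both kinds of gain function.\<close>

lemma minus_central_diff:
  fixes s :: "'g::group_add"
  assumes "s \<in> group_center" and "s + s = 0"
  shows "- (s + a - b) = s + b - a"
proof -
  have "- s = s"
    using assms(2) by (metis add_eq_0_iff)
  then have "- (s + a - b) = (b - a) + s"
    by (simp add: diff_conv_add_uminus minus_add add.assoc del: add_uminus_conv_diff)
  also have "\<dots> = s + b - a"
    using assms(1) by (simp add: group_center_def diff_conv_add_uminus add.assoc
        del: add_uminus_conv_diff)
  finally show ?thesis .
qed


section \<open>Switching equivalence\<close>

lemma equiv_switching:
  fixes \<Gamma> :: "'v pair_pre_digraph"
  shows "equiv (gain_functions \<Gamma> :: ('v \<times> 'v \<Rightarrow> 'g::group_add) set) (switching \<Gamma>)"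
    (is "equiv ?A ?R")
proof (rule equivI)
  show "?R \<subseteq> ?A \<times> ?A"
    by (auto simp: switching_def)
  show "refl_on ?A ?R"
    by (auto simp: refl_on_def switching_def intro!: exI[of _ "\<lambda>_. 0"])
  show "sym ?R"
  proof (rule symI)
    fix \<psi>1 \<psi>2 :: "'v \<times> 'v \<Rightarrow> 'g"
    assume *: "(\<psi>1, \<psi>2) \<in> switching \<Gamma>"
    then obtain f where f: "\<forall>(u, v)\<in>parcs \<Gamma>. \<psi>2 (u, v) = - f u + \<psi>1 (u, v) + f v"
      by (auto simp: switching_def)
    then have "\<forall>(u, v)\<in>parcs \<Gamma>. \<psi>1 (u, v) = - (- f u) + \<psi>2 (u, v) + - f v"
      by (auto simp: add.assoc)
    with * show "(\<psi>2, \<psi>1) \<in> switching \<Gamma>"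
      unfolding switching_def by (auto intro!: exI[of _ "\<lambda>v. - f v"])
  qed
  show "trans ?R"
  proof (rule transI)
    fix \<psi>1 \<psi>2 \<psi>3 :: "'v \<times> 'v \<Rightarrow> 'g"
    assume *: "(\<psi>1, \<psi>2) \<in> switching \<Gamma>" "(\<psi>2, \<psi>3) \<in> switching \<Gamma>"
    then obtain f g where f: "\<forall>(u, v)\<in>parcs \<Gamma>. \<psi>2 (u, v) = - f u + \<psi>1 (u, v) + f v"
      and g: "\<forall>(u, v)\<in>parcs \<Gamma>. \<psi>3 (u, v) = - g u + \<psi>2 (u, v) + g v"
      by (auto simp: switching_def)
    have "\<psi>3 (u, v) = - (f u + g u) + \<psi>1 (u, v) + (f v + g v)" if "(u, v) \<in> parcs \<Gamma>" for u v
      using bspec[OF f that] bspec[OF g that]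
      by (simp add: add.assoc minus_add diff_conv_add_uminus del: add_uminus_conv_diff)
    with * show "(\<psi>1, \<psi>3) \<in> switching \<Gamma>"
      unfolding switching_def by (auto intro!: exI[of _ "\<lambda>v. f v + g v"])
  qed
qed

lemma switching_class_eq_iff:
  assumes "\<psi>1 \<in> gain_functions \<Gamma>" and "\<psi>2 \<in> gain_functions \<Gamma>"
  shows "switching_class \<Gamma> \<psi>1 = switching_class \<Gamma> \<psi>2 \<longleftrightarrow> (\<psi>1, \<psi>2) \<in> switching \<Gamma>"
  unfolding switching_class_def by (rule eq_equiv_class_iff[OF equiv_switching assms])


section \<open>Phases as labellings of incident pairs\<close>

lemma index_in_nth: "distinct xs \<Longrightarrow> i < length xs \<Longrightarrow> index_in xs (xs ! i) = i"
  unfolding index_in_def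
  by (rule the_inv_into_f_f) (auto simp: inj_on_nth)

lemma enumerates_index_in:
  assumes "enumerates xs A" and "x \<in> A"
  shows "index_in xs x < length xs" and "xs ! index_in xs x = x"
  using assms index_in_nth[of xs] unfolding enumerates_def by (metis in_set_conv_nth)+

text \<open>Reading a phase by vertex and edge removes the chosen orders from the rest of the
  argument. The value is meaningful for incident pairs only: the other entries of a phase are 0,
  which is no group element, and \<open>gval\<close> is unspecified there.\<close>

definition phase_entry ::
    "'v list \<Rightarrow> 'v set list \<Rightarrow> 'g::group_add group_algebra mat \<Rightarrow> 'v \<Rightarrow> 'v set \<Rightarrow> 'g" where
  "phase_entry vs es H v e = gval (H $$ (index_in vs v, index_in es e))"

definition phase_of ::
    "'v list \<Rightarrow> 'v set list \<Rightarrow> ('v \<Rightarrow> 'v set \<Rightarrow> 'g::group_add) \<Rightarrow> 'g group_algebra mat" where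
  "phase_of vs es h = Matrix.mat (length vs) (length es)
     (\<lambda>(i, j). if vs ! i \<in> es ! j then gelem (h (vs ! i) (es ! j)) else 0)"

lemma phase_of_in_phases: "phase_of vs es h \<in> phases vs es"
  by (auto simp: phase_of_def phases_def)

lemma phase_entry_phase_of:
  assumes "enumerates vs V" and "enumerates es E" and "v \<in> V" and "e \<in> E" and "v \<in> e"
  shows "phase_entry vs es (phase_of vs es h) v e = h v e"
  using assms by (simp add: phase_entry_def phase_of_def enumerates_index_in)

text \<open>A phase is recovered from its labelling, so equations between phases can be turned into
  equations in the group.\<close>

lemma phase_nth:
  assumes "H \<in> phases vs es" and "distinct vs" and "distinct es"
    and "i < length vs" and "j < length es"
  shows "H $$ (i, j) =
    (if vs ! i \<in> es ! j then gelem (phase_entry vs es H (vs ! i) (es ! j)) else 0)"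
proof -
  have "if vs ! i \<in> es ! j then H $$ (i, j) \<in> range gelem else H $$ (i, j) = 0"
    using assms(1,4,5) by (simp add: phases_def)
  then show ?thesis
    using assms by (auto simp: phase_entry_def index_in_nth split: if_splits)
qed

section \<open>Left-right equivalence in terms of labellings\<close>

lemma mat_star_gdiag: "mat_star (gdiag n f) = gdiag n (\<lambda>i. - f i)"
  \<comment> \<open>Off the diagonal \<open>ga_star\<close> is applied to 0, where its defining sum
    is empty.\<close>
  by (rule eq_matI) (auto simp: mat_star_def gdiag_def mat_diag_def, simp add: ga_star_def)

lemma gdiag_sandwich:
  assumes "H \<in> carrier_mat n m"
  shows "mat_star (gdiag n f) * H * gdiag m g =
    Matrix.mat n m (\<lambda>(i, j). gelem (- f i) * H $$ (i, j) * gelem (g j))"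
proof -
  have "mat_star (gdiag n f) * H = Matrix.mat n m (\<lambda>(i, j). gelem (- f i) * H $$ (i, j))"
    unfolding mat_star_gdiag unfolding gdiag_def by (rule mat_diag_mult_left[OF assms])
  then show ?thesis
    unfolding gdiag_def by (subst mat_diag_mult_right[of _ n m]) (auto intro!: eq_matI)
qed

text \<open>The tuples in \<open>lr_equiv\<close> are carried from positions to vertices and edges,
  and both are inverted. In this form \<open>f\<close> and \<open>g\<close> are themselves the
  functions that switch the gains of \<open>H1\<close> to those of \<open>H2\<close>, on the graph
  and on its line graph respectively.\<close>

lemma lr_equiv_iff:
  assumes vs: "enumerates vs V" and es: "enumerates es E"
    and H1: "H1 \<in> phases vs es" and H2: "H2 \<in> phases vs es"
  shows "lr_equiv (length vs) (length es) H1 H2 \<longleftrightarrow>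
    (\<exists>f g. \<forall>v\<in>V. \<forall>e\<in>E. v \<in> e \<longrightarrow>
       phase_entry vs es H1 v e = f v + phase_entry vs es H2 v e - g e)"
    (is "_ \<longleftrightarrow> (\<exists>f g. ?P f g)")
proof -
  let ?n = "length vs" and ?m = "length es"
  have d: "distinct vs" "distinct es" and V: "set vs = V" and E: "set es = E"
    using vs es by (auto simp: enumerates_def)
  have c: "H1 \<in> carrier_mat ?n ?m" "H2 \<in> carrier_mat ?n ?m"
    using H1 H2 by (auto simp: phases_def)
  have key: "H1 = mat_star (gdiag ?n f) * H2 * gdiag ?m g \<longleftrightarrow>
      (\<forall>i<?n. \<forall>j<?m. vs ! i \<in> es ! j \<longrightarrow>
        phase_entry vs es H1 (vs ! i) (es ! j)
          = - f i + phase_entry vs es H2 (vs ! i) (es ! j) + g j)" for f g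
  proof -
    have "H1 = mat_star (gdiag ?n f) * H2 * gdiag ?m g \<longleftrightarrow>
      (\<forall>i<?n. \<forall>j<?m. H1 $$ (i, j) = gelem (- f i) * H2 $$ (i, j) * gelem (g j))"
      unfolding gdiag_sandwich[OF c(2)] using c(1) by (auto intro!: eq_matI)
    \<comment> \<open>At non-incident positions both sides are 0; at incident ones
      \<open>gelem\<close> is multiplicative and injective.\<close>
    also have "\<dots> \<longleftrightarrow> (\<forall>i<?n. \<forall>j<?m. vs ! i \<in> es ! j \<longrightarrow>
        phase_entry vs es H1 (vs ! i) (es ! j)
          = - f i + phase_entry vs es H2 (vs ! i) (es ! j) + g j)"
      by (auto simp: phase_nth[OF H1 d] phase_nth[OF H2 d] inj_eq[OF inj_gelem]
          simp flip: gelem_add)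
    finally show ?thesis .
  qed
  show ?thesis
  proof
    assume "lr_equiv ?n ?m H1 H2"
    then obtain f g where "H1 = mat_star (gdiag ?n f) * H2 * gdiag ?m g"
      by (auto simp: lr_equiv_def)
    with key have eq: "phase_entry vs es H1 (vs ! i) (es ! j)
        = - f i + phase_entry vs es H2 (vs ! i) (es ! j) + g j"
      if "i < ?n" "j < ?m" "vs ! i \<in> es ! j" for i j
      using that by blast
    have "?P (\<lambda>v. - f (index_in vs v)) (\<lambda>e. - g (index_in es e))"
    proof (intro ballI impI)
      fix v e
      assume "v \<in> V" "e \<in> E" "v \<in> e"
      then show "phase_entry vs es H1 v e
          = - f (index_in vs v) + phase_entry vs es H2 v e - (- g (index_in es e))"
        using eq[of "index_in vs v" "index_in es e"]
        by (simp add: enumerates_index_in[OF vs] enumerates_index_in[OF es])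
    qed
    then show "\<exists>f g. ?P f g"
      by (intro exI)
  next
    assume "\<exists>f g. ?P f g"
    then obtain f g where P: "?P f g"
      by (elim exE)
    have "H1 = mat_star (gdiag ?n (\<lambda>i. - f (vs ! i))) * H2 * gdiag ?m (\<lambda>j. - g (es ! j))"
      unfolding key
    proof (intro allI impI)
      fix i j
      assume "i < ?n" "j < ?m" and inc: "vs ! i \<in> es ! j"
      then have "vs ! i \<in> V" "es ! j \<in> E"
        using V E by auto
      with P inc show "phase_entry vs es H1 (vs ! i) (es ! j)
          = - (- f (vs ! i)) + phase_entry vs es H2 (vs ! i) (es ! j) + - g (es ! j)"
        by simp
    qed
    then show "lr_equiv ?n ?m H1 H2"
      unfolding lr_equiv_def by (intro exI)
  qed
qed


section \<open>The two gain functions of a phase\<close>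

lemma edges_arc: "(u, v) \<in> parcs \<Gamma> \<Longrightarrow> {u, v} \<in> edges \<Gamma>"
  by (auto simp: edges_def)

lemma pair_graph_arc_sym: "pair_graph \<Gamma> \<Longrightarrow> (u, v) \<in> parcs \<Gamma> \<Longrightarrow> (v, u) \<in> parcs \<Gamma>"
proof -
  assume "pair_graph \<Gamma>" and arc: "(u, v) \<in> parcs \<Gamma>"
  then interpret pair_graph \<Gamma> by simp
  show "(v, u) \<in> parcs \<Gamma>"
    using arc by (rule arcs_symmetric)
qed

lemma edge_in_verts:
  assumes "pair_graph \<Gamma>" and "e \<in> edges \<Gamma>" and "v \<in> e"
  shows "v \<in> pverts \<Gamma>"
proof -
  interpret pair_graph \<Gamma> by (rule assms(1))
  show ?thesis
    using assms(2,3) in_arcsD1 in_arcsD2 by (auto simp: edges_def)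
qed

lemma phase_gain_arc:
  "(u, v) \<in> parcs \<Gamma> \<Longrightarrow> phase_gain \<Gamma> vs es s H (u, v) =
     s + phase_entry vs es H u {u, v} - phase_entry vs es H v {u, v}"
  by (simp add: phase_gain_def phase_entry_def Let_def)

text \<open>Distinct edges have at most two elements each, so two that share \<open>v\<close> meet
  in \<open>v\<close> alone, and this is what \<open>the_elem\<close> returns.\<close>

lemma phase_line_gain_arc:
  assumes "e \<in> edges \<Gamma>" "e' \<in> edges \<Gamma>" "e \<noteq> e'" "v \<in> e" "v \<in> e'"
  shows "phase_line_gain \<Gamma> vs es s H (e, e') =
    s + - phase_entry vs es H v e + phase_entry vs es H v e'"
proof -
  have "e \<inter> e' = {v}"
    using assms by (auto simp: edges_def)
  moreover have "(e, e') \<in> parcs (line_graph \<Gamma>)"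
    using assms by (auto simp: line_graph_def)
  ultimately show ?thesis
    by (simp add: phase_line_gain_def phase_entry_def Let_def)
qed

lemma line_arc_cases:
  assumes "(e, e') \<in> parcs (line_graph \<Gamma>)"
  obtains v where "e \<in> edges \<Gamma>" "e' \<in> edges \<Gamma>" "e \<noteq> e'" "v \<in> e" "v \<in> e'" "e \<inter> e' = {v}"
proof -
  from assms obtain v where *: "e \<in> edges \<Gamma>" "e' \<in> edges \<Gamma>" "e \<noteq> e'" "v \<in> e" "v \<in> e'"
    by (auto simp: line_graph_def)
  then have "e \<inter> e' = {v}"
    by (auto simp: edges_def)
  with * show thesis
    by (rule that)
qed

text \<open>Any two distinct elements of an edge are the ends of an arc, so agreement along arcs is
  constancy on each edge. The lemma produces the edge function \<open>g\<close> from a condition on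
  a vertex function hidden in \<open>c\<close>.\<close>

lemma constant_on_edges_iff:
  "(\<forall>(u, v)\<in>parcs \<Gamma>. c u {u, v} = c v {u, v}) \<longleftrightarrow> (\<exists>g. \<forall>e\<in>edges \<Gamma>. \<forall>v\<in>e. c v e = g e)"
  (is "?L \<longleftrightarrow> ?R")
proof
  assume L: ?L
  \<comment> \<open>An arbitrary endpoint serves as base point; the value there becomes
    \<open>g e\<close>.\<close>
  have "c v e = c (SOME u. u \<in> e) e" if "e \<in> edges \<Gamma>" "v \<in> e" for e v
  proof -
    from that(1) obtain x y where e: "e = {x, y}" and "(x, y) \<in> parcs \<Gamma>"
      by (auto simp: edges_def)
    with L have "c x e = c y e"
      by auto
    moreover have "(SOME u. u \<in> e) \<in> e"
      using that(2) by (rule someI)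
    ultimately show ?thesis
      using that(2) e by auto
  qed
  then show ?R
    by (intro exI[of _ "\<lambda>e. c (SOME u. u \<in> e) e"]) blast
next
  assume ?R
  then show ?L
    using edges_arc by fastforce
qed

text \<open>The edges at a vertex are pairwise adjacent in the line graph, so any two of them are
  compared along a single arc. This is the dual of the previous lemma and produces the vertex
  function \<open>f\<close>.\<close>

lemma constant_on_stars_iff:
  "(\<forall>(e, e')\<in>parcs (line_graph \<Gamma>). \<forall>v\<in>e \<inter> e'. c v e = c v e') \<longleftrightarrow>
   (\<exists>f. \<forall>e\<in>edges \<Gamma>. \<forall>v\<in>e. c v e = f v)"
  (is "?L \<longleftrightarrow> ?R")
proof
  assume L: ?L
  have "c v e = c v (SOME e'. e' \<in> edges \<Gamma> \<and> v \<in> e')" (is "_ = c v ?e'")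
    if "e \<in> edges \<Gamma>" "v \<in> e" for e v
  proof -
    have "?e' \<in> edges \<Gamma> \<and> v \<in> ?e'"
      by (rule someI_ex) (use that in blast)
    \<comment> \<open>The line graph has no loops, so the case that \<open>e\<close> is itself the
      chosen edge is treated apart.\<close>
    then show ?thesis
      using L that by (cases "e = ?e'") (auto simp: line_graph_def)
  qed
  then show ?R
    by (intro exI[of _ "\<lambda>v. c v (SOME e'. e' \<in> edges \<Gamma> \<and> v \<in> e')"]) blast
next
  assume ?R
  then show ?L
    by (auto simp: line_graph_def)
qed

section \<open>Phases yield gain functions, and on the graph itself they yield all of them\<close>

lemma phase_gain_in_gain_functions:
  assumes "pair_graph \<Gamma>" and "s \<in> group_center" and "s + s = 0"
  shows "phase_gain \<Gamma> vs es s H \<in> gain_functions \<Gamma>"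
proof -
  have "phase_gain \<Gamma> vs es s H (v, u) = - phase_gain \<Gamma> vs es s H (u, v)"
    if "(u, v) \<in> parcs \<Gamma>" for u v
    unfolding phase_gain_arc[OF that] phase_gain_arc[OF pair_graph_arc_sym[OF assms(1) that]]
      minus_central_diff[OF assms(2,3)] by (simp add: insert_commute)
  moreover have "phase_gain \<Gamma> vs es s H \<in> extensional (parcs \<Gamma>)"
    by (simp add: phase_gain_def)
  ultimately show ?thesis
    by (auto simp: gain_functions_def)
qed

lemma phase_line_gain_in_gain_functions:
  assumes "s \<in> group_center" and "s + s = 0"
  shows "phase_line_gain \<Gamma> vs es s H \<in> gain_functions (line_graph \<Gamma>)"
proof -
  have "phase_line_gain \<Gamma> vs es s H (e', e) = - phase_line_gain \<Gamma> vs es s H (e, e')"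
    if arc: "(e, e') \<in> parcs (line_graph \<Gamma>)" for e e'
  proof -
    from arc obtain v where "e \<in> edges \<Gamma>" "e' \<in> edges \<Gamma>" "e \<noteq> e'" "v \<in> e" "v \<in> e'"
      by (rule line_arc_cases)
    then show ?thesis
      using minus_central_diff[OF assms, of "- phase_entry vs es H v e" "- phase_entry vs es H v e'"]
      by (simp add: phase_line_gain_arc[of _ _ _ v])
  qed
  moreover have "phase_line_gain \<Gamma> vs es s H \<in> extensional (parcs (line_graph \<Gamma>))"
    by (simp add: phase_line_gain_def)
  ultimately show ?thesis
    by (auto simp: gain_functions_def)
qed

text \<open>Its use is that every switching class of the graph comes from a phase, so that a map
  prescribed on the classes of phases is defined on all classes.\<close>

lemma phase_gain_surj:
  assumes \<Gamma>: "pair_graph \<Gamma>" and vs: "enumerates vs (pverts \<Gamma>)" and es: "enumerates es (edges \<Gamma>)"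
    and s: "s \<in> group_center" "s + s = 0" and \<psi>: "\<psi> \<in> gain_functions \<Gamma>"
  obtains H where "H \<in> phases vs es" and "phase_gain \<Gamma> vs es s H = \<psi>"
proof
  interpret pair_graph \<Gamma> by (rule \<Gamma>)
  define a where "a e = (SOME v. v \<in> e)" for e :: "'a set"
  \<comment> \<open>The factor \<open>s\<close> in the label cancels the one in
    \<open>phase_gain\<close>. If \<open>v\<close> is the chosen endpoint, the gain of
    \<open>(u, v)\<close> is \<open>s + (s + \<psi> (u, v))\<close>; if \<open>u\<close> is, it is
    \<open>s - (s + \<psi> (v, u))\<close>.\<close>
  define H where "H = phase_of vs es (\<lambda>v e. if v = a e then 0 else s + \<psi> (v, a e))"
  show "H \<in> phases vs es"
    unfolding H_def by (rule phase_of_in_phases)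
  have ss: "s + (s + x) = x" for x
    using s(2) by (simp flip: add.assoc)
  have "phase_gain \<Gamma> vs es s H (u, v) = \<psi> (u, v)" if arc: "(u, v) \<in> parcs \<Gamma>" for u v
  proof -
    have "a {u, v} \<in> {u, v}"
      unfolding a_def by (rule someI[of _ u]) simp
    moreover have "u \<noteq> v"
      using arc no_loops' by auto
    moreover have "\<psi> (v, u) = - \<psi> (u, v)"
      using \<psi> arc by (auto simp: gain_functions_def)
    \<comment> \<open>This is the case where the arc starts at the chosen endpoint; here
      \<open>s\<close> has to be moved past \<open>x\<close>.\<close>
    moreover have "s - (s - x) = x" for x
    proof -
      have "s + - x = - x + s"
        using s(1) unfolding group_center_def by blast
      then have "s - (s - x) = s - (- x + s)"
        by simp
      also have "\<dots> = x"
        by (simp add: diff_conv_add_uminus minus_add del: add_uminus_conv_diff)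
      finally show ?thesis .
    qed
    moreover have "u \<in> pverts \<Gamma>" "v \<in> pverts \<Gamma>"
      using arc in_arcsD1 in_arcsD2 by auto
    ultimately show ?thesis
      unfolding phase_gain_arc[OF arc]
      by (auto simp: H_def phase_entry_phase_of[OF vs es _ edges_arc[OF arc]] ss)
  qed
  then show "phase_gain \<Gamma> vs es s H = \<psi>"
    using \<psi> by (intro extensionalityI[of _ "parcs \<Gamma>"])
      (auto simp: phase_gain_def gain_functions_def)
qed


section \<open>The three equivalent conditions\<close>

text \<open>For fixed \<open>f\<close> the switching condition says that
  \<open>- ?h1 v e + f v + ?h2 v e\<close> agrees at both ends of each edge. Naming the common value
  \<open>g e\<close> and solving for \<open>?h1 v e\<close> gives the entrywise form of
  \<open>lr_equiv\<close> with the same \<open>f\<close>.\<close>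

lemma gain_switching_iff_lr_equiv:
  fixes s :: "'g::group_add"
  assumes \<Gamma>: "pair_graph \<Gamma>" and vs: "enumerates vs (pverts \<Gamma>)" and es: "enumerates es (edges \<Gamma>)"
    and s: "s \<in> group_center" "s + s = 0"
    and H: "H1 \<in> phases vs es" "H2 \<in> phases vs es"
  shows "(phase_gain \<Gamma> vs es s H1, phase_gain \<Gamma> vs es s H2) \<in> switching \<Gamma>
    \<longleftrightarrow> lr_equiv (length vs) (length es) H1 H2"
proof -
  let ?h1 = "phase_entry vs es H1" and ?h2 = "phase_entry vs es H2"
  have "phase_gain \<Gamma> vs es s H2 (u, v) = - f u + phase_gain \<Gamma> vs es s H1 (u, v) + f v \<longleftrightarrow>
      - ?h1 u {u, v} + f u + ?h2 u {u, v} = - ?h1 v {u, v} + f v + ?h2 v {u, v}"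
    if "(u, v) \<in> parcs \<Gamma>" for f u v
    unfolding phase_gain_arc[OF that] by (rule gain_switch_iff[OF s(1)])
  then have "(\<forall>(u, v)\<in>parcs \<Gamma>.
        phase_gain \<Gamma> vs es s H2 (u, v) = - f u + phase_gain \<Gamma> vs es s H1 (u, v) + f v) \<longleftrightarrow>
      (\<forall>(u, v)\<in>parcs \<Gamma>.
        - ?h1 u {u, v} + f u + ?h2 u {u, v} = - ?h1 v {u, v} + f v + ?h2 v {u, v})" for f
    by (intro ball_cong) auto
  then have "(phase_gain \<Gamma> vs es s H1, phase_gain \<Gamma> vs es s H2) \<in> switching \<Gamma> \<longleftrightarrow>
      (\<exists>f. \<forall>(u, v)\<in>parcs \<Gamma>.
        - ?h1 u {u, v} + f u + ?h2 u {u, v} = - ?h1 v {u, v} + f v + ?h2 v {u, v})"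
    by (simp add: switching_def phase_gain_in_gain_functions[OF \<Gamma> s])
  also have "\<dots> \<longleftrightarrow> (\<exists>f g. \<forall>e\<in>edges \<Gamma>. \<forall>v\<in>e. - ?h1 v e + f v + ?h2 v e = g e)"
    by (rule ex_cong1) (rule constant_on_edges_iff)
  also have "\<dots> \<longleftrightarrow> (\<exists>f g. \<forall>v\<in>pverts \<Gamma>. \<forall>e\<in>edges \<Gamma>. v \<in> e \<longrightarrow> ?h1 v e = f v + ?h2 v e - g e)"
  proof (intro ex_cong1)
    fix f g :: "_ \<Rightarrow> 'g"
    have "- a + x + b = y \<longleftrightarrow> a = x + b - y" for a b x y :: 'g
    proof -
      have "- a + x + b = y \<longleftrightarrow> a + (- a + x + b) = a + y"
        by (simp only: add_left_cancel)
      then show ?thesis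
        by (auto simp: eq_diff_eq add.assoc)
    qed
    then show "(\<forall>e\<in>edges \<Gamma>. \<forall>v\<in>e. - ?h1 v e + f v + ?h2 v e = g e) \<longleftrightarrow>
        (\<forall>v\<in>pverts \<Gamma>. \<forall>e\<in>edges \<Gamma>. v \<in> e \<longrightarrow> ?h1 v e = f v + ?h2 v e - g e)"
      using edge_in_verts[OF \<Gamma>] by (simp only:) blast
  qed
  also have "\<dots> \<longleftrightarrow> lr_equiv (length vs) (length es) H1 H2"
    by (rule lr_equiv_iff[OF vs es H, symmetric])
  finally show ?thesis .
qed

lemma line_gain_switching_iff_lr_equiv:
  fixes s :: "'g::group_add"
  assumes \<Gamma>: "pair_graph \<Gamma>" and vs: "enumerates vs (pverts \<Gamma>)" and es: "enumerates es (edges \<Gamma>)"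
    and s: "s \<in> group_center" "s + s = 0"
    and H: "H1 \<in> phases vs es" "H2 \<in> phases vs es"
  shows "(phase_line_gain \<Gamma> vs es s H1, phase_line_gain \<Gamma> vs es s H2) \<in> switching (line_graph \<Gamma>)
    \<longleftrightarrow> lr_equiv (length vs) (length es) H1 H2"
proof -
  let ?h1 = "phase_entry vs es H1" and ?h2 = "phase_entry vs es H2"
  \<comment> \<open>The intersection is a singleton; quantifying over it instead of naming its
    element gives the shape of \<open>constant_on_stars_iff\<close>.\<close>
  have "phase_line_gain \<Gamma> vs es s H2 (e, e') =
        - g e + phase_line_gain \<Gamma> vs es s H1 (e, e') + g e' \<longleftrightarrow>
      (\<forall>v\<in>e \<inter> e'. ?h1 v e + g e - ?h2 v e = ?h1 v e' + g e' - ?h2 v e')"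
    if arc: "(e, e') \<in> parcs (line_graph \<Gamma>)" for g e e'
  proof -
    from arc obtain v where v: "e \<in> edges \<Gamma>" "e' \<in> edges \<Gamma>" "e \<noteq> e'" "v \<in> e" "v \<in> e'"
      and int: "e \<inter> e' = {v}"
      by (rule line_arc_cases)
    show ?thesis
      unfolding phase_line_gain_arc[OF v] int line_gain_switch_iff[OF s(1)] by simp
  qed
  then have "(\<forall>(e, e')\<in>parcs (line_graph \<Gamma>). phase_line_gain \<Gamma> vs es s H2 (e, e') =
        - g e + phase_line_gain \<Gamma> vs es s H1 (e, e') + g e') \<longleftrightarrow>
      (\<forall>(e, e')\<in>parcs (line_graph \<Gamma>). \<forall>v\<in>e \<inter> e'.
        ?h1 v e + g e - ?h2 v e = ?h1 v e' + g e' - ?h2 v e')" for g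
    by (intro ball_cong) auto
  then have "(phase_line_gain \<Gamma> vs es s H1, phase_line_gain \<Gamma> vs es s H2) \<in> switching (line_graph \<Gamma>)
    \<longleftrightarrow> (\<exists>g. \<forall>(e, e')\<in>parcs (line_graph \<Gamma>). \<forall>v\<in>e \<inter> e'.
          ?h1 v e + g e - ?h2 v e = ?h1 v e' + g e' - ?h2 v e')"
    by (simp add: switching_def phase_line_gain_in_gain_functions[OF s])
  also have "\<dots> \<longleftrightarrow> (\<exists>g f. \<forall>e\<in>edges \<Gamma>. \<forall>v\<in>e. ?h1 v e + g e - ?h2 v e = f v)"
    by (rule ex_cong1) (rule constant_on_stars_iff)
  \<comment> \<open>Here the edge function comes first and determines the vertex function; the order
    is exchanged to meet \<open>lr_equiv_iff\<close>.\<close>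
  also have "\<dots> \<longleftrightarrow> (\<exists>f g. \<forall>e\<in>edges \<Gamma>. \<forall>v\<in>e. ?h1 v e + g e - ?h2 v e = f v)"
    by (rule ex_comm)
  also have "\<dots> \<longleftrightarrow> (\<exists>f g. \<forall>v\<in>pverts \<Gamma>. \<forall>e\<in>edges \<Gamma>. v \<in> e \<longrightarrow> ?h1 v e = f v + ?h2 v e - g e)"
  proof (intro ex_cong1)
    fix f g :: "_ \<Rightarrow> 'g"
    have "a + y - b = x \<longleftrightarrow> a = x + b - y" for a b x y :: 'g
      by (simp add: eq_diff_eq diff_eq_eq)
    then show "(\<forall>e\<in>edges \<Gamma>. \<forall>v\<in>e. ?h1 v e + g e - ?h2 v e = f v) \<longleftrightarrow>
        (\<forall>v\<in>pverts \<Gamma>. \<forall>e\<in>edges \<Gamma>. v \<in> e \<longrightarrow> ?h1 v e = f v + ?h2 v e - g e)"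
      using edge_in_verts[OF \<Gamma>] by (simp only:) blast
  qed
  also have "\<dots> \<longleftrightarrow> lr_equiv (length vs) (length es) H1 H2"
    by (rule lr_equiv_iff[OF vs es H, symmetric])
  finally show ?thesis .
qed

theorem theorem4p25:
  fixes \<Gamma> :: "'v pair_pre_digraph"
    and vs :: "'v list" and es :: "'v set list"
    and s1 s2 :: "'g::group_add"
  assumes "pair_graph \<Gamma>"
    and "Digraph_Component.connected (with_proj \<Gamma>)"
    and "edges \<Gamma> \<noteq> {}"
    and "enumerates vs (pverts \<Gamma>)"
    and "enumerates es (edges \<Gamma>)"
    and "s1 \<in> group_center" and "s2 \<in> group_center"
    and "s1 + s1 = 0" and "s2 + s2 = 0"
  shows
    "(\<forall>H1 \<in> phases vs es. \<forall>H2 \<in> phases vs es.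
        (lr_equiv (length vs) (length es) H1 H2
           \<longleftrightarrow> (phase_gain \<Gamma> vs es s1 H1, phase_gain \<Gamma> vs es s1 H2) \<in> switching \<Gamma>)
      \<and> ((phase_gain \<Gamma> vs es s1 H1, phase_gain \<Gamma> vs es s1 H2) \<in> switching \<Gamma>
           \<longleftrightarrow> (phase_line_gain \<Gamma> vs es s2 H1, phase_line_gain \<Gamma> vs es s2 H2)
                 \<in> switching (line_graph \<Gamma>)))
     \<and> (\<exists>\<L> :: ('v \<times> 'v \<Rightarrow> 'g) set \<Rightarrow> ('v set \<times> 'v set \<Rightarrow> 'g) set.
          \<L> \<in> switching_classes \<Gamma> \<rightarrow> switching_classes (line_graph \<Gamma>)
        \<and> inj_on \<L> (switching_classes \<Gamma>)
        \<and> (\<forall>H \<in> phases vs es.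
             \<L> (switching_class \<Gamma> (phase_gain \<Gamma> vs es s1 H))
               = switching_class (line_graph \<Gamma>) (phase_line_gain \<Gamma> vs es s2 H)))"
proof (intro conjI ballI)
  note \<Gamma> = assms(1) and vs = assms(4) and es = assms(5)
    and s1 = assms(6,8) and s2 = assms(7,9)
  let ?\<Psi> = "phase_gain \<Gamma> vs es s1" and ?\<Psi>L = "phase_line_gain \<Gamma> vs es s2"
  let ?cl = "switching_class \<Gamma>" and ?clL = "switching_class (line_graph \<Gamma>)"
  \<comment> \<open>Both switching conditions are compared with \<open>lr_equiv\<close>, and so with
    each other.\<close>
  note iffs = gain_switching_iff_lr_equiv[OF \<Gamma> vs es s1]
    line_gain_switching_iff_lr_equiv[OF \<Gamma> vs es s2]
  {
    fix H1 H2 :: "'g group_algebra mat"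
    assume H: "H1 \<in> phases vs es" "H2 \<in> phases vs es"
    show "lr_equiv (length vs) (length es) H1 H2 \<longleftrightarrow> (?\<Psi> H1, ?\<Psi> H2) \<in> switching \<Gamma>"
      and "(?\<Psi> H1, ?\<Psi> H2) \<in> switching \<Gamma> \<longleftrightarrow> (?\<Psi>L H1, ?\<Psi>L H2) \<in> switching (line_graph \<Gamma>)"
      using iffs[OF H] by simp_all
  }
  \<comment> \<open>Read from left to right this makes the map on classes well defined; read from
    right to left it makes it injective.\<close>
  have class_iff: "?cl (?\<Psi> H1) = ?cl (?\<Psi> H2) \<longleftrightarrow> ?clL (?\<Psi>L H1) = ?clL (?\<Psi>L H2)"
    if "H1 \<in> phases vs es" "H2 \<in> phases vs es" for H1 H2
    using that by (simp add: iffs switching_class_eq_iff phase_gain_in_gain_functions[OF \<Gamma> s1]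
        phase_line_gain_in_gain_functions[OF s2])
  define rep where "rep C = (SOME H. H \<in> phases vs es \<and> ?cl (?\<Psi> H) = C)" for C
  have rep: "rep C \<in> phases vs es" "?cl (?\<Psi> (rep C)) = C" if "C \<in> switching_classes \<Gamma>" for C
  proof -
    from that obtain \<psi> :: "'v \<times> 'v \<Rightarrow> 'g" where "\<psi> \<in> gain_functions \<Gamma>" "C = ?cl \<psi>"
      unfolding switching_classes_def switching_class_def by (rule quotientE)
    then have "\<exists>H. H \<in> phases vs es \<and> ?cl (?\<Psi> H) = C"
      using phase_gain_surj[OF \<Gamma> vs es s1] by metis
    from someI_ex[OF this] show "rep C \<in> phases vs es" "?cl (?\<Psi> (rep C)) = C"
      by (simp_all add: rep_def)
  qed
  \<comment> \<open>The value is computed from a chosen phase in the class; by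
    \<open>class_iff\<close> any other phase with the same class gives the same value.\<close>
  define \<L> where "\<L> C = ?clL (?\<Psi>L (rep C))" for C
  have "\<L> \<in> switching_classes \<Gamma> \<rightarrow> switching_classes (line_graph \<Gamma>)"
    by (auto simp: \<L>_def switching_classes_def switching_class_def
        intro!: quotientI phase_line_gain_in_gain_functions[OF s2])
  moreover have "inj_on \<L> (switching_classes \<Gamma>)"
    by (rule inj_onI) (metis \<L>_def class_iff rep)
  moreover have "\<L> (?cl (?\<Psi> H)) = ?clL (?\<Psi>L H)" if "H \<in> phases vs es" for H
  proof -
    have "?cl (?\<Psi> H) \<in> switching_classes \<Gamma>"
      by (auto simp: switching_classes_def switching_class_def
          intro!: quotientI phase_gain_in_gain_functions[OF \<Gamma> s1])
    from rep[OF this] show ?thesis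
      unfolding \<L>_def using class_iff that by blast
  qed
  ultimately show "\<exists>\<L> :: ('v \<times> 'v \<Rightarrow> 'g) set \<Rightarrow> ('v set \<times> 'v set \<Rightarrow> 'g) set.
          \<L> \<in> switching_classes \<Gamma> \<rightarrow> switching_classes (line_graph \<Gamma>)
        \<and> inj_on \<L> (switching_classes \<Gamma>)
        \<and> (\<forall>H \<in> phases vs es. \<L> (?cl (?\<Psi> H)) = ?clL (?\<Psi>L H))"
    by blast
qed

end
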